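(* (i) Every Markov fraction is the middle element of a unique centered rational Markov triple. (ii) If $\big(\frac{p_1}{q_1},\frac{p_2}{q_2},\frac{p_3}{q_3}\big)$ is a centered rational Markov triple, then the best approximants of $\frac{p_2}{q_2}$ are precisely $\frac{p_1}{q_1}$ and $\frac{p_3}{q_3}$, i.e. $$C\Big(\frac{p_2}{q_2}\Big)=q_1^2\Big(\frac{p_2}{q_2}-\frac{p_1}{q_1}\Big)=q_3^2\Big(\frac{p_3}{q_3}-\frac{p_2}{q_2}\Big),$$ and for every rational number $\frac ab$ not contained in the triple, $$C\Big(\frac{p_2}{q_2}\Big)<b^2\Big|\frac{p_2}{q_2}-\frac ab\Big|.$$ In particular, $$C\Big(\frac{p_2}{q_2}\Big)=\frac{q_1q_3}{q_2}>\frac13.$$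
   Context: For $x\in\mathbb{R}$ the approximation constant is $C(x)=\inf_{\frac ab\in\mathbb{Q}\setminus\{x\}} b^2\,\big|x-\frac ab\big|$. A Markov triple is a triple $(q_1,q_2,q_3)$ of positive integers with $q_1^2+q_2^2+q_3^2=3q_1q_2q_3$. A triple of rational numbers $(x_1,x_2,x_3)$ is a rational Markov triple if $x_k=\frac{p_k}{q_k}$ for some Markov triple $(q_1,q_2,q_3)$ and some integers $p_1,p_2,p_3$ satisfying $p_2q_1-p_1q_2=q_3$ and $p_3q_2-p_2q_3=q_1$. (Then the fractions $\frac{p_k}{q_k}$ are automatically reduced, so the $q_k$ are determined by the $x_k$.) A Markov fraction is a rational number that is an element of some rational Markov triple. Writing a rational Markov triple as $\big(\frac{p_1}{q_1},\frac{p_2}{q_2},\frac{p_3}{q_3}\big)$ means that $(q_1,q_2,q_3)$ is a Markov triple and $p_1,p_2,p_3$ are integers satisfying $p_2q_1-p_1q_2=q_3$ and $p_3q_2-p_2q_3=q_1$. It is called centered if $q_2\ge\max\{q_1,q_3\}$. *)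

theory Defs
  imports Complex_Main
begin

text \<open>The infimum ranges over all ways of writing a rational number different from \<open>x\<close> as \<open>a/b\<close>
  with \<open>b > 0\<close>. Passing to lowest terms only decreases \<open>b\<^sup>2 \<bar>x - a/b\<bar>\<close>, so restricting to
  coprime \<open>a\<close>, \<open>b\<close> would give the same value.\<close>

definition approx_const :: "real \<Rightarrow> real" where
  "approx_const x =
     Inf {(of_int b)\<^sup>2 * \<bar>x - of_int a / of_int b\<bar> | a b :: int.
            b > 0 \<and> of_int a / of_int b \<noteq> x}"

definition best_approximant :: "real \<Rightarrow> rat \<Rightarrow> bool" where
  "best_approximant x r \<longleftrightarrow>
     (\<exists>a b :: int. b > 0 \<and> r = of_int a / of_int b \<and> of_rat r \<noteq> x \<and>
        (of_int b)\<^sup>2 * \<bar>x - of_int a / of_int b\<bar> = approx_const x)"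

definition markov_triple :: "int \<Rightarrow> int \<Rightarrow> int \<Rightarrow> bool" where
  "markov_triple q1 q2 q3 \<longleftrightarrow>
     q1 > 0 \<and> q2 > 0 \<and> q3 > 0 \<and> q1\<^sup>2 + q2\<^sup>2 + q3\<^sup>2 = 3 * q1 * q2 * q3"

text \<open>The numerators and denominators in a rational Markov triple
  \<open>(p1/q1, p2/q2, p3/q3)\<close>.\<close>

definition rational_markov_rep :: "int \<Rightarrow> int \<Rightarrow> int \<Rightarrow> int \<Rightarrow> int \<Rightarrow> int \<Rightarrow> bool" where
  "rational_markov_rep p1 q1 p2 q2 p3 q3 \<longleftrightarrow>
     markov_triple q1 q2 q3 \<and> p2 * q1 - p1 * q2 = q3 \<and> p3 * q2 - p2 * q3 = q1"

definition rational_markov_triple :: "rat \<times> rat \<times> rat \<Rightarrow> bool" where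
  "rational_markov_triple t \<longleftrightarrow>
     (\<exists>p1 q1 p2 q2 p3 q3. rational_markov_rep p1 q1 p2 q2 p3 q3 \<and>
        t = (of_int p1 / of_int q1, of_int p2 / of_int q2, of_int p3 / of_int q3))"

definition centered_rational_markov_triple :: "rat \<times> rat \<times> rat \<Rightarrow> bool" where
  "centered_rational_markov_triple t \<longleftrightarrow>
     (\<exists>p1 q1 p2 q2 p3 q3. rational_markov_rep p1 q1 p2 q2 p3 q3 \<and>
        t = (of_int p1 / of_int q1, of_int p2 / of_int q2, of_int p3 / of_int q3) \<and>
        q2 \<ge> max q1 q3)"

definition markov_fraction :: "rat \<Rightarrow> bool" where
  "markov_fraction x \<longleftrightarrow>
     (\<exists>x1 x2 x3. rational_markov_triple (x1, x2, x3) \<and> x \<in> {x1, x2, x3})"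

end

theory Submission
  imports Defs
begin

text \<open>For a pair \<open>(a, b)\<close> and a rational Markov triple \<open>(p1/q1, p2/q2, p3/q3)\<close>, the determinants of
  \<open>(a, b)\<close> with the vectors \<open>(1, 0)\<close>, \<open>(p3, q3)\<close> and \<open>(p2, q2)\<close> are, with suitable signs, the integers
  \<open>x = b\<close>, \<open>y = a q3 - p3 b\<close> and \<open>z = p2 b - a q2\<close>. The equation \<open>p3 q2 - p2 q3 = q1\<close> says
  that \<open>q1 x + q2 y + q3 z = 0\<close>, and \<open>b\<^sup>2 \<bar>p2/q2 - a/b\<bar> = \<bar>x z\<bar> / q2\<close>. The
  approximation statement is therefore a purely arithmetic one: if an integer vector is orthogonal to
  a Markov triple with largest entry \<open>q2\<close>, then \<open>\<bar>x z\<bar> \<ge> q1 q3\<close> unless the product vanishes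
  (\<open>markov_max_product\<close>). Equality forces \<open>y = 0\<close> or \<open>y' = 0\<close> with \<open>q2 y' = q1 z - q3 x\<close>; as
  \<open>y' = p1 b - q1 a\<close> by the other determinant equation, these are the cases
  \<open>a/b = p3/q3\<close> and \<open>a/b = p1/q1\<close>.

  The inequality is proved by descent in the Markov tree, for which it must be strengthened to a
  lower bound on all nonzero products \<open>x y\<close>, \<open>y z\<close>, \<open>x z\<close> (\<open>markov_product_bounds\<close>). Replacing the
  largest entry \<open>b\<close> of a Markov triple \<open>(a, b, c)\<close> by its conjugate \<open>b' = 3ac - b\<close> turns the vector
  \<open>(x, y, z)\<close> into two vectors, one with entries \<open>x, y, y'\<close> and one with entries \<open>z, y, y'\<close> up to sign,
  both orthogonal to the smaller triple. The bounds known for them control every product except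
  \<open>x z\<close>, and \<open>\<bar>x z\<bar>\<close> is a positive combination of a square and a product that is controlled
  (\<open>large_product_of_relation\<close>). In geometric terms the entries of a Markov triple are the edge
  lengths of ideal triangles whose vertices are cusps, \<open>x, y, z\<close> are lengths from the vertices of one
  triangle to a further cusp, and the passage to the conjugate is a flip of the longest edge.

  Uniqueness of the centered triple around a Markov fraction follows from the approximation
  statement: the outer members are the best approximants of the middle one, and their order on the
  line is prescribed. Existence is again a descent: a cyclic rotation, with one fraction translated
  by 3, brings any member of a triple to the middle, and conjugating the larger outer denominator
  while it exceeds the middle one lowers the sum of the outer denominators
  (\<open>rational_markov_rep_centered\<close>).\<close>

section \<open>The tree of Markov triples\<close>

lemma markov_triple_swap12: "markov_triple a b c \<Longrightarrow> markov_triple b a c"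
  and markov_triple_swap23: "markov_triple a b c \<Longrightarrow> markov_triple a c b"
  by (auto simp: markov_triple_def algebra_simps)

text \<open>The Markov equation is quadratic in \<open>b\<close>; its roots have sum \<open>3ac\<close> and product \<open>a\<^sup>2 + c\<^sup>2\<close>.\<close>
lemma markov_conjugate_prod:
  assumes "markov_triple a b c"
  shows "b * (3 * a * c - b) = a\<^sup>2 + c\<^sup>2"
  using assms by (auto simp: markov_triple_def algebra_simps power2_eq_square)

lemma markov_conjugate_pos:
  assumes "markov_triple a b c"
  shows "0 < 3 * a * c - b"
proof -
  have "b > 0" "0 < a\<^sup>2 + c\<^sup>2"
    using assms by (auto simp: markov_triple_def intro: add_pos_pos)
  then show ?thesis
    using markov_conjugate_prod[OF assms] by (metis zero_less_mult_pos)
qed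

lemma markov_triple_conjugate:
  assumes "markov_triple a b c"
  shows "markov_triple a (3 * a * c - b) c"
proof -
  have "a\<^sup>2 + (3 * a * c - b)\<^sup>2 + c\<^sup>2 = 3 * a * (3 * a * c - b) * c"
    using assms by (auto simp: markov_triple_def algebra_simps power2_eq_square)
  then show ?thesis
    using assms markov_conjugate_pos[OF assms] by (simp add: markov_triple_def)
qed

text \<open>The larger outer entry lies between the two roots of the quadratic equation satisfied by the
  maximal entry, because the quadratic polynomial is not positive there. Hence conjugating the
  maximal entry makes a triple smaller, except for \<open>(1, 1, 1)\<close>, whose conjugate is \<open>(1, 2, 1)\<close>.\<close>
lemma markov_max_strict:
  assumes "markov_triple a b c" "a \<le> b" "c \<le> b" "(a, b, c) \<noteq> (1, 1, 1)"
  shows "a < b \<and> c < b \<and> 3 * a * c - b \<le> max a c"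
proof -
  have ordered: "a < b \<and> 3 * a * c - b \<le> a"
    if M: "markov_triple a b c" and le: "a \<le> b" "c \<le> a" and ne: "(a, b, c) \<noteq> (1, 1, 1)"
    for a b c :: int
  proof -
    have pos: "a > 0" "c > 0" using M by (auto simp: markov_triple_def)
    have sq: "c\<^sup>2 \<le> a\<^sup>2" using le(2) pos by (simp add: power_mono)
    (* the left-hand side is the quadratic with roots b and its conjugate, evaluated at a *)
    have val: "(a - b) * (a - (3 * a * c - b)) = 2 * a\<^sup>2 + c\<^sup>2 - 3 * a\<^sup>2 * c"
      using markov_conjugate_prod[OF M] by (simp add: algebra_simps power2_eq_square)
    have grow: "3 * a\<^sup>2 \<le> 3 * a\<^sup>2 * c"
      using pos by simp
    have "a \<noteq> b"
    proof
      assume eq: "a = b"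
      then have "3 * a\<^sup>2 * c = 2 * a\<^sup>2 + c\<^sup>2" using val by simp
      then have "3 * a\<^sup>2 * c \<le> 3 * a\<^sup>2 * 1" "c\<^sup>2 = a\<^sup>2" using sq grow by auto
      moreover have "3 * a\<^sup>2 > 0" using pos by simp
      ultimately have "c \<le> 1" "c = a" using pos
        by (auto simp only: mult_le_cancel_left_pos power2_eq_iff_nonneg less_imp_le)
      then show False using ne eq pos by simp
    qed
    then have "a < b" using le by simp
    moreover have "(b - a) * (a - (3 * a * c - b)) \<ge> 0"
      using val sq grow by (simp add: algebra_simps)
    ultimately show ?thesis by (simp add: zero_le_mult_iff)
  qed
  show ?thesis
  proof (cases "c \<le> a")
    case True
    then show ?thesis using ordered[of a b c] assms by auto
  next
    case False
    have "markov_triple c b a" using assms(1) by (auto simp: markov_triple_def algebra_simps)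
    then show ?thesis using ordered[of c b a] assms False by (auto simp: mult.commute mult.left_commute)
  qed
qed

text \<open>Conjugating the maximal entry lowers the sum of the entries, so every Markov triple comes from
  \<open>(1, 1, 1)\<close>. The two transpositions let the conjugation step assume that the maximum is in the
  middle.\<close>
lemma markov_triple_induct [consumes 1, case_names unit swap12 swap23 conjugate]:
  assumes "markov_triple a b c"
    and unit: "P 1 1 1"
    and swap12: "\<And>a b c. markov_triple a b c \<Longrightarrow> P a b c \<Longrightarrow> P b a c"
    and swap23: "\<And>a b c. markov_triple a b c \<Longrightarrow> P a b c \<Longrightarrow> P a c b"
    and conjugate: "\<And>a b c. markov_triple a b c \<Longrightarrow> a < b \<Longrightarrow> c < b \<Longrightarrow>
      3 * a * c - b \<le> max a c \<Longrightarrow> P a (3 * a * c - b) c \<Longrightarrow> P a b c"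
  shows "P a b c"
  using assms(1)
proof (induction "nat (a + b + c)" arbitrary: a b c rule: less_induct)
  case less
  have descend: "P d e f"
    if M: "markov_triple d e f" and max: "d \<le> e" "f \<le> e" and ne: "(d, e, f) \<noteq> (1, 1, 1)"
      and size: "d + e + f = a + b + c" for d e f
  proof -
    note strict = markov_max_strict[OF M max ne]
    have conj: "markov_triple d (3 * d * f - e) f" by (rule markov_triple_conjugate[OF M])
    have "nat (d + (3 * d * f - e) + f) < nat (a + b + c)"
      using strict size M by (auto simp: markov_triple_def)
    then have "P d (3 * d * f - e) f" by (rule less.hyps[OF _ conj])
    then show ?thesis using conjugate M strict by blast
  qed
  have M: "markov_triple a b c" by fact
  consider "(a, b, c) = (1, 1, 1)"
    | "(a, b, c) \<noteq> (1, 1, 1)" "a \<le> b" "c \<le> b"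
    | "(a, b, c) \<noteq> (1, 1, 1)" "b \<le> a" "c \<le> a"
    | "(a, b, c) \<noteq> (1, 1, 1)" "a \<le> c" "b \<le> c" by linarith
  then show ?case
  proof cases
    case 1 then show ?thesis using unit by simp
  next
    case 2 then show ?thesis using descend[OF M] by simp
  next
    case 3
    then have "P b a c" using descend[OF markov_triple_swap12[OF M]] by auto
    then show ?thesis by (rule swap12[OF markov_triple_swap12[OF M]])
  next
    case 4
    then have "P a c b" using descend[OF markov_triple_swap23[OF M]] by auto
    then show ?thesis by (rule swap23[OF markov_triple_swap23[OF M]])
  qed
qed

text \<open>A conjugation changes \<open>b\<close> by its sign and a multiple of \<open>ac\<close>, so it preserves the greatest
  common divisors of \<open>b\<close> with the other entries.\<close>
lemma markov_triple_coprime: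
  assumes "markov_triple a b c"
  shows "coprime a b \<and> coprime b c \<and> coprime a c"
  using assms
proof (induction rule: markov_triple_induct)
  case (conjugate a b c)
  have "gcd a b = gcd a (3 * a * c - b)"
    using gcd_add_mult[of a "- (3 * c)" "3 * a * c - b"] by (simp add: algebra_simps gcd_diff2)
  moreover have "gcd c b = gcd c (3 * a * c - b)"
    using gcd_add_mult[of c "- (3 * a)" "3 * a * c - b"] by (simp add: algebra_simps)
  ultimately show ?case
    using conjugate.IH by (simp add: coprime_iff_gcd_eq_1 gcd.commute)
qed (auto simp: coprime_commute)

section \<open>Integer vectors orthogonal to a Markov triple\<close>

text \<open>The sign of \<open>W\<close> decides which side of the relation is a sum of positive terms. If \<open>W > 0\<close>,
  multiply \<open>a Z = c X + b W\<close> by \<open>X\<close>: the bound on \<open>X W\<close> alone already yields \<open>X Z \<ge> a c\<close>, and the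
  remaining term \<open>c X\<^sup>2\<close> makes the inequality strict. If \<open>W < 0\<close>, multiply by \<open>Z\<close> instead. The value
  \<open>m = ca/b\<close> is the one for which the bounds on \<open>X W\<close> and \<open>Z W\<close> are just strong enough.\<close>
lemma large_product_of_relation:
  fixes a b c X Z W m :: real
  assumes pos: "0 < a" "0 < b" "0 < c" "0 < X" "0 < Z"
    and rel: "b * W = a * Z - c * X" and "W \<noteq> 0"
    and m: "m * b = c * a"
    and bounds: "m * a \<le> X * \<bar>W\<bar>" "m * c \<le> Z * \<bar>W\<bar>"
  shows "a * c < X * Z"
proof (cases "W > 0")
  case True
  have "a * (a * c) = b * (m * a)" using m by (simp add: algebra_simps)
  also have "\<dots> \<le> b * (X * W)" using bounds(1) pos True by simp
  also have "\<dots> < c * X\<^sup>2 + X * (b * W)" using pos by simp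
  also have "\<dots> = a * (X * Z)" unfolding rel by (simp add: algebra_simps power2_eq_square)
  finally show ?thesis using pos by simp
next
  case False
  have "c * (a * c) = b * (m * c)" using m by (simp add: algebra_simps)
  also have "\<dots> \<le> b * (Z * (- W))"
    using bounds(2) pos False by (intro mult_left_mono) auto
  also have "\<dots> < a * Z\<^sup>2 - Z * (b * W)" using pos by simp
  also have "\<dots> = c * (X * Z)" unfolding rel by (simp add: algebra_simps power2_eq_square)
  finally show ?thesis using pos by simp
qed

text \<open>Each product of two coordinates is at least \<open>m\<close> times the entry that belongs to the third one.
  The three conditions on \<open>m\<close> amount to \<open>m \<le> abc / (max a b c)\<^sup>2\<close>. Quantifying over \<open>m\<close> rather than
  fixing this value makes the property symmetric in the three entries and does not mention which of
  them is the largest.\<close>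
definition has_product_bounds :: "int \<Rightarrow> int \<Rightarrow> int \<Rightarrow> bool" where
  "has_product_bounds a b c \<longleftrightarrow>
     (\<forall>(x :: int) (y :: int) (z :: int) (m :: real).
        a * x + b * y + c * z = 0 \<and> m * of_int a \<le> of_int (b * c) \<and>
        m * of_int b \<le> of_int (c * a) \<and> m * of_int c \<le> of_int (a * b) \<longrightarrow>
        (x * y \<noteq> 0 \<longrightarrow> m * of_int c \<le> of_int \<bar>x * y\<bar>) \<and>
        (y * z \<noteq> 0 \<longrightarrow> m * of_int a \<le> of_int \<bar>y * z\<bar>) \<and>
        (x * z \<noteq> 0 \<longrightarrow> m * of_int b \<le> of_int \<bar>x * z\<bar>))"

lemma has_product_boundsD:
  fixes x y z :: int and m :: real
  assumes "has_product_bounds a b c" "a * x + b * y + c * z = 0"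
    and "m * of_int a \<le> of_int (b * c)" "m * of_int b \<le> of_int (c * a)" "m * of_int c \<le> of_int (a * b)"
  shows "x * y \<noteq> 0 \<Longrightarrow> m * of_int c \<le> of_int \<bar>x * y\<bar>"
    and "y * z \<noteq> 0 \<Longrightarrow> m * of_int a \<le> of_int \<bar>y * z\<bar>"
    and "x * z \<noteq> 0 \<Longrightarrow> m * of_int b \<le> of_int \<bar>x * z\<bar>"
  using assms unfolding has_product_bounds_def by blast+

text \<open>If \<open>x\<close> and \<open>z\<close> have the same sign, then \<open>b y' = a z - c x\<close> is a difference of two terms of
  equal sign; otherwise this is true of \<open>- b y = a x + c z\<close>. So one of \<open>y'\<close>, \<open>y\<close> always fits the
  preceding inequality.\<close>
lemma large_product_of_bounds:
  fixes a b c x y y' z :: int and m :: real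
  assumes pos: "0 < a" "0 < b" "0 < c"
    and y: "a * x + b * y + c * z = 0" and y': "b * y' = a * z - c * x"
    and m: "m * b = c * a"
    and bounds: "m * of_int c \<le> of_int \<bar>x * y\<bar>" "m * of_int a \<le> of_int \<bar>y * z\<bar>"
      "m * of_int a \<le> of_int \<bar>x * y'\<bar>" "m * of_int c \<le> of_int \<bar>y' * z\<bar>"
    and nz: "x * z \<noteq> 0" "y \<noteq> 0" "y' \<noteq> 0"
  shows "a * c < \<bar>x * z\<bar>"
proof (cases "x * z > 0")
  case True
  have "b * (sgn x * y') = a * \<bar>z\<bar> - c * \<bar>x\<bar>"
    using y' True by (auto simp: zero_less_mult_iff sgn_if algebra_simps)
  note rel = arg_cong[OF this, of real_of_int]
  have "real_of_int a * c < \<bar>x\<bar> * \<bar>z\<bar>"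
    using large_product_of_relation[of a b c "\<bar>x\<bar>" "\<bar>z\<bar>" "of_int (sgn x * y')" m] pos nz bounds m rel
    by (cases "0 < x") (auto simp: abs_mult sgn_if mult.commute)
  then show ?thesis by (metis abs_mult of_int_less_iff of_int_mult)
next
  case False
  have "x < 0 \<and> 0 < z \<or> 0 < x \<and> z < 0" using False nz(1) by (auto simp: zero_less_mult_iff)
  then have "b * (sgn x * y) = c * \<bar>z\<bar> - a * \<bar>x\<bar>"
    using y by (auto simp: sgn_if algebra_simps)
  note rel = arg_cong[OF this, of real_of_int]
  have "real_of_int c * a < \<bar>x\<bar> * \<bar>z\<bar>"
    using large_product_of_relation[of c b a "\<bar>x\<bar>" "\<bar>z\<bar>" "of_int (sgn x * y)" m] pos nz bounds m rel
    by (cases "0 < x") (auto simp: abs_mult sgn_if mult.commute)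
  then show ?thesis by (metis abs_mult mult.commute of_int_less_iff of_int_mult)
qed

lemma product_ge_of_proportional:
  fixes a c x z :: int
  assumes "coprime a c" "0 < a" "0 < c" "a * \<bar>z\<bar> = c * \<bar>x\<bar>" "x * z \<noteq> 0"
  shows "a * c \<le> \<bar>x * z\<bar>"
proof -
  have "a dvd \<bar>x\<bar>" using assms(1,4) by (metis coprime_dvd_mult_right_iff dvd_triv_left)
  moreover have "c dvd \<bar>z\<bar>"
    using assms(1,4) by (metis coprime_commute coprime_dvd_mult_right_iff dvd_triv_left)
  ultimately have "a \<le> \<bar>x\<bar>" "c \<le> \<bar>z\<bar>" using assms(5) by (auto intro: zdvd_imp_le)
  then show ?thesis using assms by (simp add: abs_mult mult_mono)
qed

text \<open>The number \<open>y'\<close> takes the place of the coordinate at the new vertex after a flip: the conjugate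
  triple is orthogonal to vectors with entries \<open>x, y, y'\<close> and with entries \<open>z, y, y'\<close> up to sign. It is an
  integer because \<open>a (a z - c x) \<equiv> (a\<^sup>2 + c\<^sup>2) z\<close> modulo \<open>b\<close>, where \<open>a\<^sup>2 + c\<^sup>2\<close> is a multiple of \<open>b\<close>
  and \<open>a\<close> is coprime to \<open>b\<close>.\<close>
lemma conjugate_relation:
  fixes a b c x y z :: int
  assumes "markov_triple a b c" "a * x + b * y + c * z = 0"
  obtains y' where "b * y' = a * z - c * x"
    "(3 * a * c - b) * x + a * y + c * y' = 0"
    "(3 * a * c - b) * z + c * y - a * y' = 0"
proof -
  let ?b' = "3 * a * c - b"
  have b: "b \<noteq> 0" using assms(1) by (auto simp: markov_triple_def)
  have prod: "b * ?b' = a\<^sup>2 + c\<^sup>2" by (rule markov_conjugate_prod[OF assms(1)])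
  have "a * (a * z - c * x) = b * (?b' * z + c * y)"
    using prod assms(2) by algebra
  then have "b dvd a * (a * z - c * x)" by simp
  moreover have "coprime b a" using markov_triple_coprime[OF assms(1)] by (simp add: coprime_commute)
  ultimately have "b dvd a * z - c * x" by (simp add: coprime_dvd_mult_right_iff)
  then obtain y' where y': "b * y' = a * z - c * x" by (metis dvdE)
  have "b * (?b' * x + a * y + c * y') = 0" using prod assms(2) y' by algebra
  moreover have "b * (?b' * z + c * y - a * y') = 0" using prod assms(2) y' by algebra
  ultimately show thesis using that y' b by simp
qed

text \<open>The induction rests on the fact that the extremal value of \<open>m\<close> does not decrease under descent:
  \<open>m0 = ca/b\<close>, extremal for \<open>(a, b, c)\<close>, is still admissible for \<open>(a, b', c)\<close>, since \<open>a\<^sup>2\<close> and \<open>c\<^sup>2\<close> are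
  at most \<open>b b' = a\<^sup>2 + c\<^sup>2\<close> and \<open>b' \<le> b\<close>.\<close>
lemma markov_product_bounds:
  assumes "markov_triple a b c"
  shows "has_product_bounds a b c"
  using assms
proof (induction rule: markov_triple_induct)
  case unit
  have "m * 1 \<le> \<bar>u\<bar>" if "m \<le> 1" "u \<noteq> 0" for m :: real and u :: int
    using that by (metis mult.right_neutral of_int_1_le_iff order_trans zero_less_abs_iff int_one_le_iff_zero_less)
  then show ?case unfolding has_product_bounds_def by (auto simp del: of_int_abs)
next
  case (swap12 a b c)
  show ?case unfolding has_product_bounds_def
  proof (intro allI impI, elim conjE)
    fix x y z :: int and m :: real
    assume "b * x + a * y + c * z = 0" "m * of_int b \<le> of_int (a * c)" "m * of_int a \<le> of_int (c * b)" "m * of_int c \<le> of_int (b * a)"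
    then show "(x * y \<noteq> 0 \<longrightarrow> m * of_int c \<le> of_int \<bar>x * y\<bar>) \<and> (y * z \<noteq> 0 \<longrightarrow> m * of_int b \<le> of_int \<bar>y * z\<bar>) \<and>
        (x * z \<noteq> 0 \<longrightarrow> m * of_int a \<le> of_int \<bar>x * z\<bar>)"
      using has_product_boundsD[OF swap12.IH, of y x z m] by (simp add: algebra_simps)
  qed
next
  case (swap23 a b c)
  show ?case unfolding has_product_bounds_def
  proof (intro allI impI, elim conjE)
    fix x y z :: int and m :: real
    assume "a * x + c * y + b * z = 0" "m * of_int a \<le> of_int (c * b)" "m * of_int c \<le> of_int (b * a)" "m * of_int b \<le> of_int (a * c)"
    then show "(x * y \<noteq> 0 \<longrightarrow> m * of_int b \<le> of_int \<bar>x * y\<bar>) \<and> (y * z \<noteq> 0 \<longrightarrow> m * of_int a \<le> of_int \<bar>y * z\<bar>) \<and>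
        (x * z \<noteq> 0 \<longrightarrow> m * of_int c \<le> of_int \<bar>x * z\<bar>)"
      using has_product_boundsD[OF swap23.IH, of x z y m] by (simp add: algebra_simps)
  qed
next
  case (conjugate a b c)
  let ?b' = "3 * a * c - b"
  have pos: "0 < a" "0 < b" "0 < c" using conjugate.hyps(1) by (auto simp: markov_triple_def)
  have prod: "b * ?b' = a\<^sup>2 + c\<^sup>2" by (rule markov_conjugate_prod[OF conjugate.hyps(1)])
  define m0 :: real where "m0 = c * a / b"
  have m0: "m0 * b = c * a" "0 < m0" using pos by (auto simp: m0_def)
  (* for the two outer entries, multiply by b and use a^2, c^2 <= b * b' *)
  have adm: "m0 * a \<le> ?b' * c" "m0 * ?b' \<le> c * a" "m0 * c \<le> a * ?b'"
  proof -
    have "real_of_int b * (m0 * a) = c * (real_of_int a)\<^sup>2"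
      using m0(1) by (simp add: algebra_simps power2_eq_square)
    also have "\<dots> \<le> c * real_of_int (b * ?b')" using pos unfolding prod by simp
    also have "\<dots> = b * (?b' * c)" by simp
    finally show "m0 * a \<le> ?b' * c" using pos by simp
    have "real_of_int b * (m0 * c) = a * (real_of_int c)\<^sup>2"
      using m0(1) by (simp add: algebra_simps power2_eq_square)
    also have "\<dots> \<le> a * real_of_int (b * ?b')" using pos unfolding prod by simp
    also have "\<dots> = b * (a * ?b')" by simp
    finally show "m0 * c \<le> a * ?b'" using pos by simp
    have "real_of_int ?b' \<le> b" using conjugate.hyps by linarith
    then have "m0 * ?b' \<le> m0 * b" using m0(2) by (intro mult_left_mono) auto
    then show "m0 * ?b' \<le> c * a" using m0(1) by simp
  qed
  show ?case unfolding has_product_bounds_def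
  proof (intro allI impI, elim conjE)
    fix x y z :: int and m :: real
    assume rel: "a * x + b * y + c * z = 0" and m: "m * of_int b \<le> of_int (c * a)"
    have "m * b \<le> m0 * b" using m m0 by simp
    then have "m \<le> m0" using pos by simp
    then have mm: "m * a \<le> m0 * a" "m * c \<le> m0 * c" using pos by auto
    obtain y' where y': "b * y' = a * z - c * x"
      and r1: "?b' * x + a * y + c * y' = 0" and r2: "?b' * z + c * y - a * y' = 0"
      using conjugate_relation[OF conjugate.hyps(1) rel] .
    note D1 = has_product_boundsD[OF conjugate.IH, of y x y' m0]
      and D2 = has_product_boundsD[OF conjugate.IH, of "- y'" z y m0]
    have b1: "x * y \<noteq> 0 \<Longrightarrow> m0 * of_int c \<le> of_int \<bar>x * y\<bar>" "x * y' \<noteq> 0 \<Longrightarrow> m0 * of_int a \<le> of_int \<bar>x * y'\<bar>"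
      using D1 r1 adm by (auto simp: algebra_simps)
    have b2: "y * z \<noteq> 0 \<Longrightarrow> m0 * of_int a \<le> of_int \<bar>y * z\<bar>" "y' * z \<noteq> 0 \<Longrightarrow> m0 * of_int c \<le> of_int \<bar>y' * z\<bar>"
      using D2 r2 adm by (auto simp: algebra_simps)
    have "a * c \<le> \<bar>x * z\<bar>" if nz: "x * z \<noteq> 0"
    proof (cases "y = 0 \<or> y' = 0")
      (* the vectors (x, z) and (a, c) are then proportional up to sign and order, and coprimality
         makes the factor an integer *)
      case True
      then have "a * z = c * x \<or> a * x = c * (- z)" using rel y' by auto
      then have "\<bar>a * z\<bar> = \<bar>c * x\<bar> \<or> \<bar>a * x\<bar> = \<bar>c * (- z)\<bar>" by metis
      then have "a * \<bar>z\<bar> = c * \<bar>x\<bar> \<or> a * \<bar>x\<bar> = c * \<bar>z\<bar>"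
        using pos by (simp add: abs_mult)
      then show ?thesis
        using product_ge_of_proportional[of a c z x] product_ge_of_proportional[of a c x z] nz pos
          markov_triple_coprime[OF conjugate.hyps(1)] by (auto simp: mult.commute)
    next
      case False
      then have "a * c < \<bar>x * z\<bar>"
        using large_product_of_bounds[OF pos rel y' m0(1)] b1 b2 nz by auto
      then show ?thesis by simp
    qed
    then have "x * z \<noteq> 0 \<longrightarrow> m * of_int b \<le> of_int \<bar>x * z\<bar>"
      using m by (metis mult.commute of_int_le_iff order_trans)
    then show "(x * y \<noteq> 0 \<longrightarrow> m * of_int c \<le> of_int \<bar>x * y\<bar>) \<and> (y * z \<noteq> 0 \<longrightarrow> m * of_int a \<le> of_int \<bar>y * z\<bar>) \<and>
        (x * z \<noteq> 0 \<longrightarrow> m * of_int b \<le> of_int \<bar>x * z\<bar>)"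
      using b1(1) b2(1) mm by linarith
  qed
qed

text \<open>Equality can only occur when \<open>y\<close> or \<open>y'\<close> vanishes: otherwise the bounds on the products with \<open>y\<close>
  and, after rotating \<open>(x, z)\<close> to \<open>(z, -x)\<close>, with \<open>y'\<close> give the strict inequality.\<close>
lemma markov_max_product:
  fixes x y y' z :: int
  assumes M: "markov_triple a b c" and max: "a \<le> b" "c \<le> b"
    and rel: "a * x + b * y + c * z = 0" and y': "b * y' = a * z - c * x"
    and nz: "x * z \<noteq> 0"
  shows "a * c \<le> \<bar>x * z\<bar>" and "y \<noteq> 0 \<Longrightarrow> y' \<noteq> 0 \<Longrightarrow> a * c < \<bar>x * z\<bar>"
proof -
  have pos: "0 < a" "0 < b" "0 < c" using M by (auto simp: markov_triple_def)
  define m :: real where "m = c * a / b"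
  have m: "m * b = c * a" "0 < m" using pos by (auto simp: m_def)
  have "m \<le> a" "m \<le> c" using pos max by (auto simp: m_def divide_le_eq)
  then have adm: "m * of_int a \<le> of_int (b * c)" "m * of_int b \<le> of_int (c * a)" "m * of_int c \<le> of_int (a * b)"
    using mult_mono[of m c a b] mult_mono[of m a c b] m pos max by (auto simp: mult.commute)
  note D1 = has_product_boundsD[OF markov_product_bounds[OF M] rel adm]
  have rel': "a * z + b * (- y') + c * (- x) = 0" using y' by simp
  note D2 = has_product_boundsD[OF markov_product_bounds[OF M] rel' adm]
  have "m * of_int b \<le> of_int \<bar>x * z\<bar>" using D1(3) nz by simp
  then show "a * c \<le> \<bar>x * z\<bar>" unfolding m(1) by (metis mult.commute of_int_le_iff)
  show "a * c < \<bar>x * z\<bar>" if "y \<noteq> 0" "y' \<noteq> 0"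
    by (rule large_product_of_bounds[OF pos rel y' m(1)])
      (use D1 D2 nz that in \<open>auto simp: mult.commute\<close>)
qed

section \<open>Best approximants of the middle fraction\<close>

text \<open>Here \<open>x = b\<close>, \<open>y = a q3 - p3 b\<close>, \<open>z = p2 b - a q2\<close> and \<open>y' = p1 b - a q1\<close>, so \<open>y\<close> and \<open>y'\<close> vanish
  exactly when \<open>a/b\<close> is an outer fraction of the triple.\<close>
lemma rational_markov_rep_int_bound:
  assumes R: "rational_markov_rep p1 q1 p2 q2 p3 q3" and max: "max q1 q3 \<le> q2"
    and "b > 0" and ne: "a * q2 \<noteq> p2 * b"
  shows "q1 * q3 \<le> b * \<bar>p2 * b - a * q2\<bar>"
    and "a * q1 \<noteq> p1 * b \<Longrightarrow> a * q3 \<noteq> p3 * b \<Longrightarrow> q1 * q3 < b * \<bar>p2 * b - a * q2\<bar>"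
proof -
  have M: "markov_triple q1 q2 q3" and d: "p2 * q1 - p1 * q2 = q3" "p3 * q2 - p2 * q3 = q1"
    using R by (auto simp: rational_markov_rep_def)
  have "q1 * b + q2 * (a * q3 - p3 * b) + q3 * (p2 * b - a * q2) = 0"
    unfolding d(2)[symmetric] by (simp add: algebra_simps)
  moreover have "q2 * (p1 * b - a * q1) = q1 * (p2 * b - a * q2) - q3 * b"
    unfolding d(1)[symmetric] by (simp add: algebra_simps)
  moreover have "b * (p2 * b - a * q2) \<noteq> 0" using \<open>b > 0\<close> ne by auto
  ultimately have "q1 * q3 \<le> \<bar>b * (p2 * b - a * q2)\<bar>"
    and "a * q3 - p3 * b \<noteq> 0 \<Longrightarrow> p1 * b - a * q1 \<noteq> 0 \<Longrightarrow> q1 * q3 < \<bar>b * (p2 * b - a * q2)\<bar>"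
    using markov_max_product[OF M] max by auto
  then show "q1 * q3 \<le> b * \<bar>p2 * b - a * q2\<bar>"
    and "a * q1 \<noteq> p1 * b \<Longrightarrow> a * q3 \<noteq> p3 * b \<Longrightarrow> q1 * q3 < b * \<bar>p2 * b - a * q2\<bar>"
    using \<open>b > 0\<close> by (auto simp: abs_mult)
qed

lemma approx_error_eq:
  fixes a b p q :: int
  assumes "b > 0" "q > 0"
  shows "(of_int b)\<^sup>2 * \<bar>of_int p / of_int q - of_int a / of_int b :: real\<bar> =
    of_int (b * \<bar>p * b - a * q\<bar>) / of_int q"
proof -
  have "of_int p / of_int q - of_int a / of_int b = (of_int (p * b - a * q) / of_int (q * b) :: real)"
    using assms by (simp add: field_simps)
  then show ?thesis using assms by (simp add: abs_mult power2_eq_square)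
qed

lemma rational_markov_rep_approx:
  assumes R: "rational_markov_rep p1 q1 p2 q2 p3 q3" and max: "max q1 q3 \<le> q2"
  shows approx_const_markov: "approx_const (of_int p2 / of_int q2) = of_int (q1 * q3) / of_int q2"
    and approx_error_gt: "\<And>a b :: int. b > 0 \<Longrightarrow> (of_int a / of_int b :: real) \<notin>
          {of_int p1 / of_int q1, of_int p2 / of_int q2, of_int p3 / of_int q3} \<Longrightarrow>
        approx_const (of_int p2 / of_int q2) <
          (of_int b)\<^sup>2 * \<bar>of_int p2 / of_int q2 - of_int a / of_int b\<bar>"
    and left_error: "of_int (q1 * q3) / of_int q2 =
        (of_int q1)\<^sup>2 * (of_int p2 / of_int q2 - of_int p1 / of_int q1 :: real)"
    and right_error: "of_int (q1 * q3) / of_int q2 =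
        (of_int q3)\<^sup>2 * (of_int p3 / of_int q3 - of_int p2 / of_int q2 :: real)"
proof -
  have M: "markov_triple q1 q2 q3" and d: "p2 * q1 - p1 * q2 = q3" "p3 * q2 - p2 * q3 = q1"
    using R by (auto simp: rational_markov_rep_def)
  have pos: "0 < q1" "0 < q2" "0 < q3" using M by (auto simp: markov_triple_def)
  have frac_eq: "of_int a / of_int b = (of_int p / of_int q :: real) \<longleftrightarrow> a * q = p * b"
    if "b > 0" "q > 0" for a b p q :: int
    using that by (simp add: frac_eq_eq flip: of_int_mult)
  let ?x = "of_int p2 / of_int q2 :: real"
  show left: "of_int (q1 * q3) / of_int q2 =
      (of_int q1)\<^sup>2 * (of_int p2 / of_int q2 - of_int p1 / of_int q1 :: real)"
    unfolding d(1)[symmetric] using pos by (simp add: field_simps power2_eq_square)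
  show "of_int (q1 * q3) / of_int q2 =
      (of_int q3)\<^sup>2 * (of_int p3 / of_int q3 - of_int p2 / of_int q2 :: real)"
    unfolding d(2)[symmetric] using pos by (simp add: field_simps power2_eq_square)
  show const: "approx_const ?x = of_int (q1 * q3) / of_int q2"
    unfolding approx_const_def
  proof (rule cInf_eq_minimum)
    have "?x - of_int p1 / of_int q1 > 0"
      using left pos by (metis divide_pos_pos mult_pos_pos of_int_0_less_iff zero_less_mult_pos zero_less_power)
    then have "of_int (q1 * q3) / of_int q2 = (of_int q1)\<^sup>2 * \<bar>?x - of_int p1 / of_int q1\<bar>
        \<and> of_int p1 / of_int q1 \<noteq> ?x"
      using left by auto
    then show "of_int (q1 * q3) / of_int q2 \<in> {(of_int b)\<^sup>2 * \<bar>?x - of_int a / of_int b\<bar> | a b :: int.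
            b > 0 \<and> of_int a / of_int b \<noteq> ?x}"
      using pos by blast
  next
    fix e assume "e \<in> {(of_int b)\<^sup>2 * \<bar>?x - of_int a / of_int b\<bar> | a b :: int.
            b > 0 \<and> of_int a / of_int b \<noteq> ?x}"
    then obtain a b :: int where e: "e = (of_int b)\<^sup>2 * \<bar>?x - of_int a / of_int b\<bar>"
      and b: "b > 0" "of_int a / of_int b \<noteq> ?x" by blast
    have "q1 * q3 \<le> b * \<bar>p2 * b - a * q2\<bar>"
      using rational_markov_rep_int_bound(1)[OF R max b(1)] frac_eq b pos by blast
    then show "of_int (q1 * q3) / of_int q2 \<le> e"
      unfolding e approx_error_eq[OF b(1) pos(2)] using pos
      by (intro divide_right_mono) (simp_all only: of_int_le_iff of_int_0_le_iff less_imp_le)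
  qed
  fix a b :: int
  assume b: "b > 0" and ne: "(of_int a / of_int b :: real) \<notin>
          {of_int p1 / of_int q1, of_int p2 / of_int q2, of_int p3 / of_int q3}"
  have "q1 * q3 < b * \<bar>p2 * b - a * q2\<bar>"
    using rational_markov_rep_int_bound(2)[OF R max b] frac_eq[OF b] ne pos by auto
  then show "approx_const ?x < (of_int b)\<^sup>2 * \<bar>?x - of_int a / of_int b\<bar>"
    unfolding const approx_error_eq[OF b pos(2)] using pos
    by (intro divide_strict_right_mono) (simp_all only: of_int_less_iff of_int_0_less_iff)
qed

lemma rational_markov_rep_order:
  assumes "rational_markov_rep p1 q1 p2 q2 p3 q3"
  shows "of_int p1 / of_int q1 < (of_int p2 / of_int q2 :: 'a :: linordered_field)"
    and "of_int p2 / of_int q2 < (of_int p3 / of_int q3 :: 'a)"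
proof -
  have pos: "0 < q1" "0 < q2" "0 < q3" and d: "p1 * q2 < p2 * q1" "p2 * q3 < p3 * q2"
    using assms by (auto simp: rational_markov_rep_def markov_triple_def)
  have "of_int (p1 * q2) < (of_int (p2 * q1) :: 'a)" "of_int (p2 * q3) < (of_int (p3 * q2) :: 'a)"
    using d by (simp_all only: of_int_less_iff)
  then show "of_int p1 / of_int q1 < (of_int p2 / of_int q2 :: 'a)"
    and "of_int p2 / of_int q2 < (of_int p3 / of_int q3 :: 'a)"
    using pos by (simp_all add: frac_less_eq divide_less_eq less_divide_eq mult.commute)
qed

lemma best_approximants_markov:
  assumes R: "rational_markov_rep p1 q1 p2 q2 p3 q3" and max: "max q1 q3 \<le> q2"
  shows "{r. best_approximant (of_int p2 / of_int q2) r} = {of_int p1 / of_int q1, of_int p3 / of_int q3}"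
proof (intro equalityI subsetI)
  note facts = approx_const_markov[OF R max] left_error[OF R max] right_error[OF R max]
  note order = rational_markov_rep_order[OF R, where 'a = real]
  have pos: "0 < q1" "0 < q3"
    using R by (auto simp: rational_markov_rep_def markov_triple_def)
  fix r :: rat
  {
    assume "r \<in> {r. best_approximant (of_int p2 / of_int q2) r}"
    then obtain a b :: int where b: "b > 0" and r: "r = of_int a / of_int b"
      and ne: "of_rat r \<noteq> (of_int p2 / of_int q2 :: real)"
      and eq: "(of_int b)\<^sup>2 * \<bar>of_int p2 / of_int q2 - of_int a / of_int b\<bar> =
          approx_const (of_int p2 / of_int q2)"
      by (auto simp: best_approximant_def)
    have r': "of_rat r = (of_int a / of_int b :: real)" by (simp add: r of_rat_divide)
    have "of_rat r \<in> {of_int p1 / of_int q1, of_int p3 / of_int q3 :: real}"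
      using approx_error_gt[OF R max b, of a] eq ne unfolding r' by auto
    then have "of_rat r \<in> {of_rat (of_int p1 / of_int q1), of_rat (of_int p3 / of_int q3) :: real}"
      by (simp add: of_rat_divide)
    then show "r \<in> {of_int p1 / of_int q1, of_int p3 / of_int q3}"
      by (simp only: of_rat_eq_iff insert_iff empty_iff)
  }
  {
    assume "r \<in> {of_int p1 / of_int q1, of_int p3 / of_int q3}"
    moreover have "best_approximant (of_int p2 / of_int q2) (of_int p1 / of_int q1)"
      unfolding best_approximant_def
      using pos(1) order facts by (intro exI[of _ p1] exI[of _ q1]) (auto simp: of_rat_divide)
    moreover have "best_approximant (of_int p2 / of_int q2) (of_int p3 / of_int q3)"
      unfolding best_approximant_def
      using pos(2) order facts by (intro exI[of _ p3] exI[of _ q3]) (auto simp: of_rat_divide)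
    ultimately show "r \<in> {r. best_approximant (of_int p2 / of_int q2) r}" by blast
  }
qed

section \<open>Centered triples\<close>

text \<open>Translating the first fraction by 3 and moving it to the end is again a triple because the
  outer fractions satisfy \<open>p3 q1 - p1 q3 = 3 q1 q3 - q2\<close>, the conjugate of the middle denominator.\<close>
lemma rational_markov_rep_rotate:
  assumes "rational_markov_rep p1 q1 p2 q2 p3 q3"
  shows "rational_markov_rep p2 q2 p3 q3 (p1 + 3 * q1) q1"
    and "rational_markov_rep (p3 - 3 * q3) q3 p1 q1 p2 q2"
proof -
  have M: "markov_triple q1 q2 q3" and d: "p2 * q1 - p1 * q2 = q3" "p3 * q2 - p2 * q3 = q1"
    using assms by (auto simp: rational_markov_rep_def)
  have "q2 * (p3 * q1 - p1 * q3) = q2 * (3 * q1 * q3 - q2)"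
    using markov_conjugate_prod[OF M] d by algebra
  then have outer: "p3 * q1 - p1 * q3 = 3 * q1 * q3 - q2" using M by (auto simp: markov_triple_def)
  have "markov_triple q2 q3 q1" "markov_triple q3 q1 q2"
    using M by (auto simp: markov_triple_def algebra_simps)
  then show "rational_markov_rep p2 q2 p3 q3 (p1 + 3 * q1) q1"
    and "rational_markov_rep (p3 - 3 * q3) q3 p1 q1 p2 q2"
    using d outer by (auto simp: rational_markov_rep_def algebra_simps)
qed

text \<open>Conjugating an outer denominator puts a new fraction between the two that are kept. Its vector
  is \<open>3 q3 (p2, q2) - (p1, q1)\<close>, or \<open>3 q1 (p2, q2) - (p3, q3)\<close> on the other side.\<close>
lemma rational_markov_rep_conjugate:
  assumes "rational_markov_rep p1 q1 p2 q2 p3 q3"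
  shows "rational_markov_rep p2 q2 (3 * q3 * p2 - p1) (3 * q2 * q3 - q1) p3 q3"
    and "rational_markov_rep p1 q1 (3 * q1 * p2 - p3) (3 * q1 * q2 - q3) p2 q2"
proof -
  have M: "markov_triple q1 q2 q3" and d: "p2 * q1 - p1 * q2 = q3" "p3 * q2 - p2 * q3 = q1"
    using assms by (auto simp: rational_markov_rep_def)
  have outer: "p3 * q1 - p1 * q3 = 3 * q1 * q3 - q2"
    using rational_markov_rep_rotate(1)[OF assms] by (simp add: rational_markov_rep_def algebra_simps)
  have "markov_triple q2 q1 q3" "markov_triple q1 q3 q2"
    using M by (auto intro: markov_triple_swap12 markov_triple_swap23)
  then have "markov_triple q2 (3 * q2 * q3 - q1) q3" "markov_triple q1 (3 * q1 * q2 - q3) q2"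
    by (auto dest: markov_triple_conjugate)
  moreover have "(3 * q3 * p2 - p1) * q2 - p2 * (3 * q2 * q3 - q1) = p2 * q1 - p1 * q2"
    "p3 * (3 * q2 * q3 - q1) - (3 * q3 * p2 - p1) * q3 = 3 * q3 * (p3 * q2 - p2 * q3) - (p3 * q1 - p1 * q3)"
    "(3 * q1 * p2 - p3) * q1 - p1 * (3 * q1 * q2 - q3) = 3 * q1 * (p2 * q1 - p1 * q2) - (p3 * q1 - p1 * q3)"
    "p2 * (3 * q1 * q2 - q3) - (3 * q1 * p2 - p3) * q2 = p3 * q2 - p2 * q3"
    by (simp_all add: algebra_simps)
  ultimately show "rational_markov_rep p2 q2 (3 * q3 * p2 - p1) (3 * q2 * q3 - q1) p3 q3"
    and "rational_markov_rep p1 q1 (3 * q1 * p2 - p3) (3 * q1 * q2 - q3) p2 q2"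
    unfolding d outer by (simp_all add: rational_markov_rep_def)
qed

text \<open>If an outer denominator exceeds the middle one, then the larger outer one is the maximum of the
  triple, and its conjugate is smaller. The middle fraction becomes an outer one when its neighbour is
  conjugated; a rotation restores it to the middle.\<close>
lemma rational_markov_rep_centered:
  assumes "rational_markov_rep p1 q1 p2 q2 p3 q3"
  shows "\<exists>r1 s1 r3 s3. rational_markov_rep r1 s1 p2 q2 r3 s3 \<and> max s1 s3 \<le> q2"
  using assms
proof (induction "nat (q1 + q3)" arbitrary: p1 q1 p3 q3 rule: less_induct)
  case less
  note R = less.prems
  have M: "markov_triple q1 q2 q3" using R by (simp add: rational_markov_rep_def)
  have pos: "0 < q1" "0 < q2" "0 < q3" using M by (auto simp: markov_triple_def)
  consider "max q1 q3 \<le> q2" | "q2 < q1" "q3 \<le> q1" | "q2 < q3" "q1 \<le> q3" by linarith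
  then show ?case
  proof cases
    case 1
    then show ?thesis using R by blast
  next
    case 2
    have "3 * q2 * q3 - q1 < q1"
      using markov_max_strict[OF markov_triple_swap12[OF M]] 2 pos by fastforce
    then have "nat (q3 + (3 * q2 * q3 - q1)) < nat (q1 + q3)" using pos by linarith
    then show ?thesis
      using less.hyps rational_markov_rep_rotate(2)[OF rational_markov_rep_conjugate(1)[OF R]] by blast
  next
    case 3
    have "3 * q1 * q2 - q3 < q3"
      using markov_max_strict[OF markov_triple_swap23[OF M]] 3 pos by fastforce
    then have "nat ((3 * q1 * q2 - q3) + q1) < nat (q1 + q3)" using pos by linarith
    then show ?thesis
      using less.hyps rational_markov_rep_rotate(1)[OF rational_markov_rep_conjugate(2)[OF R]] by blast
  qed
qed

lemma markov_fraction_centered_exists: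
  assumes "markov_fraction x"
  shows "\<exists>t. centered_rational_markov_triple t \<and> fst (snd t) = x"
proof -
  obtain p1 q1 p2 q2 p3 q3 where R: "rational_markov_rep p1 q1 p2 q2 p3 q3"
    and x: "x \<in> {of_int p1 / of_int q1, of_int p2 / of_int q2, of_int p3 / of_int q3}"
    using assms by (auto simp: markov_fraction_def rational_markov_triple_def)
  obtain r1 s1 p q r3 s3 where "rational_markov_rep r1 s1 p q r3 s3" and x: "x = of_int p / of_int q"
    using R rational_markov_rep_rotate[OF R] x by blast
  then obtain r1 s1 r3 s3 where "rational_markov_rep r1 s1 p q r3 s3" "max s1 s3 \<le> q"
    using rational_markov_rep_centered by blast
  then have "centered_rational_markov_triple
      (of_int r1 / of_int s1, of_int p / of_int q, of_int r3 / of_int s3)"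
    unfolding centered_rational_markov_triple_def by blast
  then show ?thesis unfolding x by (intro exI conjI) auto
qed

lemma centered_best_approximants:
  assumes "centered_rational_markov_triple (x1, x2, x3)"
  shows "{r. best_approximant (of_rat x2) r} = {x1, x3}" and "x1 < x2" "x2 < x3"
proof -
  obtain p1 q1 p2 q2 p3 q3 where R: "rational_markov_rep p1 q1 p2 q2 p3 q3"
    and x: "x1 = of_int p1 / of_int q1" "x2 = of_int p2 / of_int q2" "x3 = of_int p3 / of_int q3"
    and max: "max q1 q3 \<le> q2"
    using assms by (auto simp: centered_rational_markov_triple_def)
  show "{r. best_approximant (of_rat x2) r} = {x1, x3}"
    using best_approximants_markov[OF R max] by (simp add: x of_rat_divide)
  show "x1 < x2" "x2 < x3" unfolding x by (rule rational_markov_rep_order[OF R])+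
qed

text \<open>Both pairs of outer fractions are the set of best approximants of \<open>x\<close>, and in each triple the
  smaller one comes first.\<close>
lemma centered_rational_markov_triple_unique:
  assumes "centered_rational_markov_triple (x1, x, x3)" "centered_rational_markov_triple (y1, x, y3)"
  shows "y1 = x1 \<and> y3 = x3"
proof -
  have "{x1, x3} = {y1, y3}"
    using centered_best_approximants(1)[OF assms(1)] centered_best_approximants(1)[OF assms(2)] by simp
  then show ?thesis
    using centered_best_approximants(2,3)[OF assms(1)] centered_best_approximants(2,3)[OF assms(2)]
    by (auto simp: doubleton_eq_iff)
qed

theorem theorem3p6:
  "(\<forall>x :: rat. markov_fraction x \<longrightarrow>
      (\<exists>!t. centered_rational_markov_triple t \<and> fst (snd t) = x)) \<and>
   (\<forall>p1 q1 p2 q2 p3 q3 :: int.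
      rational_markov_rep p1 q1 p2 q2 p3 q3 \<and> q2 \<ge> max q1 q3 \<longrightarrow>
        {r. best_approximant (of_int p2 / of_int q2) r} =
          {of_int p1 / of_int q1, of_int p3 / of_int q3} \<and>
        approx_const (of_int p2 / of_int q2) =
          (of_int q1)\<^sup>2 * (of_int p2 / of_int q2 - of_int p1 / of_int q1) \<and>
        approx_const (of_int p2 / of_int q2) =
          (of_int q3)\<^sup>2 * (of_int p3 / of_int q3 - of_int p2 / of_int q2) \<and>
        (\<forall>a b :: int. b > 0 \<longrightarrow>
           (of_int a / of_int b :: real) \<notin>
             {of_int p1 / of_int q1, of_int p2 / of_int q2, of_int p3 / of_int q3} \<longrightarrow>
           approx_const (of_int p2 / of_int q2) <
             (of_int b)\<^sup>2 * \<bar>of_int p2 / of_int q2 - of_int a / of_int b\<bar>) \<and>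
        approx_const (of_int p2 / of_int q2) = of_int (q1 * q3) / of_int q2 \<and>
        (of_int (q1 * q3) / of_int q2 :: real) > 1 / 3)"
proof (intro conjI allI impI; (elim conjE)?)
  fix x :: rat
  assume "markov_fraction x"
  then obtain t where t: "centered_rational_markov_triple t" "fst (snd t) = x"
    using markov_fraction_centered_exists by blast
  show "\<exists>!t. centered_rational_markov_triple t \<and> fst (snd t) = x"
  proof (rule ex1I[of _ t])
    fix s assume "centered_rational_markov_triple s \<and> fst (snd s) = x"
    then show "s = t"
      using t centered_rational_markov_triple_unique by (cases s; cases t) auto
  qed (use t in simp)
next
  fix p1 q1 p2 q2 p3 q3 :: int
  assume R: "rational_markov_rep p1 q1 p2 q2 p3 q3" and max: "max q1 q3 \<le> q2"
  note const = approx_const_markov[OF R max]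
  show "{r. best_approximant (of_int p2 / of_int q2) r} = {of_int p1 / of_int q1, of_int p3 / of_int q3}"
    by (rule best_approximants_markov[OF R max])
  show "approx_const (of_int p2 / of_int q2) = of_int (q1 * q3) / of_int q2"
    by (rule const)
  show "approx_const (of_int p2 / of_int q2) =
      (of_int q1)\<^sup>2 * (of_int p2 / of_int q2 - of_int p1 / of_int q1)"
    using const left_error[OF R max] by simp
  show "approx_const (of_int p2 / of_int q2) =
      (of_int q3)\<^sup>2 * (of_int p3 / of_int q3 - of_int p2 / of_int q2)"
    using const right_error[OF R max] by simp
  show "approx_const (of_int p2 / of_int q2) <
      (of_int b)\<^sup>2 * \<bar>of_int p2 / of_int q2 - of_int a / of_int b\<bar>"
    if "b > 0" "(of_int a / of_int b :: real) \<notin>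
      {of_int p1 / of_int q1, of_int p2 / of_int q2, of_int p3 / of_int q3}" for a b :: int
    by (rule approx_error_gt[OF R max that])
  have M: "markov_triple q1 q2 q3" using R by (simp add: rational_markov_rep_def)
  then have "q2 < 3 * (q1 * q3)" "0 < q2"
    using markov_conjugate_pos[OF M] by (auto simp: markov_triple_def)
  then have "real_of_int q2 < 3 * of_int (q1 * q3)" "0 < real_of_int q2" by linarith+
  then show "(of_int (q1 * q3) / of_int q2 :: real) > 1 / 3" by (simp add: field_simps)
qed

end
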